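(* Let $J\ge 3$. The subfamily of canonical models $\{(\text{reference},\text{logistic},Z);\ Z\in\mathfrak{Z}\}$ is stable under all permutations of $\{1,\dots,J\}$.
   Context: Setting. Let $J\ge 3$ (number of categories), $p\ge 1$, and let $\mathcal{X}\subseteq\mathbb{R}^p$ be the nonempty set of values of the explanatory vector $x$. Let $\mathcal{M}=\{\pi\in\,]0,1[^{J-1} : \sum_{j=1}^{J-1}\pi_j<1\}$; for $\pi\in\mathcal{M}$ put $\pi_J=1-\sum_{j=1}^{J-1}\pi_j$ ($\pi_j$ is the probability of category $j$). Ratio. The reference ratio $r:\mathcal{M}\to\,]0,1[^{J-1}$ is $r_j(\pi)=\pi_j/(\pi_j+\pi_J)$, $j=1,\dots,J-1$; it is a bijection onto $]0,1[^{J-1}$. Cdf. The logistic cdf is $F(w)=e^w/(1+e^w)$, $w\in\mathbb{R}$. Design matrices. The complete design matrix $Z_c(x)$ is the $(J-1)\times(J-1)(1+p)$ matrix with $Z_c(x)\beta=(\alpha_j+x^t\delta_j)_{j=1,\dots,J-1}$ for $\beta=(\alpha_1,\dots,\alpha_{J-1},\delta_1^t,\dots,\delta_{J-1}^t)^t$, $\alpha_j\in\mathbb{R}$, $\delta_j\in\mathbb{R}^p$. The set $\mathfrak{Z}$ of design matrices consists of all matrix functions $Z:x\mapsto Z_c(x)C$, where $C$ is a constant real matrix of full column rank with $q$ columns, $J-1+p\le q\le (J-1)(1+p)$. Models. The model $(\text{reference},\text{logistic},Z)$, with $Z$ having $q$ columns, has parameter space $\mathbb{R}^q$. For $\beta\in\mathbb{R}^q$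 and $x\in\mathcal{X}$, it defines the unique $\pi=\pi(x;\beta)\in\mathcal{M}$ with $r(\pi)=(F(\eta_1),\dots,F(\eta_{J-1}))^t$, where $\eta=Z(x)\beta$. Permuted models. For a permutation $\sigma$ of $\{1,\dots,J\}$ and $\pi\in\mathcal{M}$, let $\pi_\sigma=(\pi_{\sigma(1)},\dots,\pi_{\sigma(J-1)})\in\mathcal{M}$. The permuted model $(r,F,Z)_\sigma$ has the same parameter space as $(r,F,Z)$ and defines $\pi=\pi(x;\beta)\in\mathcal{M}$ by $r(\pi_\sigma)=(F(\eta_1),\dots,F(\eta_{J-1}))^t$, $\eta=Z(x)\beta$. Two (possibly permuted) models are equal if they have the same parameter space and give the same $\pi(x;\beta)$ for all $x\in\mathcal{X}$ and all $\beta$ in it. A family of models $\mathfrak{M}$ is stable under $\sigma$ if $\sigma(\mathfrak{M})=\mathfrak{M}$, where $\sigma(\mathfrak{M})=\{(r,F,Z)_\sigma : (r,F,Z)\in\mathfrak{M}\}$ and equal models are identified (i.e. every model of each of the two sets is equal to some model of the other). *)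

theory Defs
  imports Complex_Main "HOL-Combinatorics.Permutations" "Jordan_Normal_Form.DL_Rank"
begin

(* Vectors and matrices are 0-indexed, categories are numbered 1..J: entry i of a vector of
   dimension J - 1 belongs to category Suc i. *)

definition prob_simplex :: "nat \<Rightarrow> real vec set" where
  "prob_simplex J = {\<pi> \<in> carrier_vec (J - 1).
     (\<forall>i<J - 1. 0 < \<pi> $ i \<and> \<pi> $ i < 1) \<and> (\<Sum>i<J - 1. \<pi> $ i) < 1}"

definition cat_prob :: "nat \<Rightarrow> real vec \<Rightarrow> nat \<Rightarrow> real" where
  "cat_prob J \<pi> j = (if j = J then 1 - (\<Sum>i<J - 1. \<pi> $ i) else \<pi> $ (j - 1))"

definition reference :: "nat \<Rightarrow> real vec \<Rightarrow> real vec" where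
  "reference J \<pi> =
     vec (J - 1) (\<lambda>i. cat_prob J \<pi> (Suc i) / (cat_prob J \<pi> (Suc i) + cat_prob J \<pi> J))"

definition logistic :: "real \<Rightarrow> real" where
  "logistic w = exp w / (1 + exp w)"

(* The columns J - 1, J, ... carry delta_1, ..., delta_(J-1), in consecutive blocks of length p. *)
definition complete_design :: "nat \<Rightarrow> nat \<Rightarrow> real vec \<Rightarrow> real mat" where
  "complete_design J p x = mat (J - 1) ((J - 1) * (1 + p)) (\<lambda>(i, k).
     if k < J - 1 then (if k = i then 1 else 0)
     else (if (k - (J - 1)) div p = i then x $ ((k - (J - 1)) mod p) else 0))"

definition design_matrices :: "nat \<Rightarrow> nat \<Rightarrow> (real vec \<Rightarrow> real mat) set" where
  "design_matrices J p = {(\<lambda>x. complete_design J p x * C) | C q.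
     C \<in> carrier_mat ((J - 1) * (1 + p)) q \<and> vec_space.rank ((J - 1) * (1 + p)) C = q \<and>
     J - 1 + p \<le> q \<and> q \<le> (J - 1) * (1 + p)}"

record model =
  params :: "real vec set"
  probs :: "real vec \<Rightarrow> real vec \<Rightarrow> real vec"

(* R^q, where q is the common number of columns of the matrices Z x, x in X
   (see param_space_design below). *)
definition param_space :: "real vec set \<Rightarrow> (real vec \<Rightarrow> real mat) \<Rightarrow> real vec set" where
  "param_space X Z = {\<beta>. \<forall>x\<in>X. \<beta> \<in> carrier_vec (dim_col (Z x))}"

type_synonym model_spec = "(real vec \<Rightarrow> real vec) \<times> (real \<Rightarrow> real) \<times> (real vec \<Rightarrow> real mat)"

fun model_of :: "nat \<Rightarrow> real vec set \<Rightarrow> model_spec \<Rightarrow> model" where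
  "model_of J X (r, F, Z) =
     \<lparr> params = param_space X Z,
       probs = (\<lambda>x \<beta>. THE \<pi>. \<pi> \<in> prob_simplex J \<and> r \<pi> = map_vec F (Z x *\<^sub>v \<beta>)) \<rparr>"

definition permute_probs :: "nat \<Rightarrow> (nat \<Rightarrow> nat) \<Rightarrow> real vec \<Rightarrow> real vec" where
  "permute_probs J \<sigma> \<pi> = vec (J - 1) (\<lambda>i. cat_prob J \<pi> (\<sigma> (Suc i)))"

fun permuted_model_of :: "nat \<Rightarrow> real vec set \<Rightarrow> (nat \<Rightarrow> nat) \<Rightarrow> model_spec \<Rightarrow> model" where
  "permuted_model_of J X \<sigma> (r, F, Z) =
     \<lparr> params = param_space X Z,
       probs = (\<lambda>x \<beta>. THE \<pi>. \<pi> \<in> prob_simplex J \<and>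
                          r (permute_probs J \<sigma> \<pi>) = map_vec F (Z x *\<^sub>v \<beta>)) \<rparr>"

definition model_eq :: "real vec set \<Rightarrow> model \<Rightarrow> model \<Rightarrow> bool" where
  "model_eq X M N \<longleftrightarrow> params M = params N \<and>
     (\<forall>x\<in>X. \<forall>\<beta>\<in>params M. probs M x \<beta> = probs N x \<beta>)"

definition family_eq :: "real vec set \<Rightarrow> model set \<Rightarrow> model set \<Rightarrow> bool" where
  "family_eq X \<A> \<B> \<longleftrightarrow>
     (\<forall>M\<in>\<A>. \<exists>N\<in>\<B>. model_eq X M N) \<and> (\<forall>N\<in>\<B>. \<exists>M\<in>\<A>. model_eq X N M)"

definition stable_under :: "nat \<Rightarrow> real vec set \<Rightarrow> (nat \<Rightarrow> nat) \<Rightarrow> model_spec set \<Rightarrow> bool" where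
  "stable_under J X \<sigma> \<MM> \<longleftrightarrow>
     family_eq X (permuted_model_of J X \<sigma> ` \<MM>) (model_of J X ` \<MM>)"

definition canonical_models :: "nat \<Rightarrow> nat \<Rightarrow> model_spec set" where
  "canonical_models J p = {(reference J, logistic, Z) | Z. Z \<in> design_matrices J p}"

lemma param_space_design:
  assumes "C \<in> carrier_mat ((J - 1) * (1 + p)) q" "X \<noteq> {}"
  shows "param_space X (\<lambda>x. complete_design J p x * C) = carrier_vec q"
  using assms by (auto simp: param_space_def)

lemma sum_lessThan_add:
  fixes g :: "nat \<Rightarrow> real"
  shows "(\<Sum>k<m + n. g k) = (\<Sum>k<m. g k) + (\<Sum>k<n. g (m + k))"
  by (induction n) simp_all

lemma complete_design_mult:
  assumes \<alpha>: "\<alpha> \<in> carrier_vec (J - 1)"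
    and \<delta>: "\<And>j. j < J - 1 \<Longrightarrow> \<delta> j \<in> carrier_vec p"
    and x: "x \<in> carrier_vec p"
  shows "complete_design J p x *\<^sub>v
           (\<alpha> @\<^sub>v vec ((J - 1) * p) (\<lambda>k. \<delta> (k div p) $ (k mod p)))
         = vec (J - 1) (\<lambda>j. \<alpha> $ j + x \<bullet> \<delta> j)" (is "?Z *\<^sub>v ?\<beta> = ?\<eta>")
proof (rule eq_vecI)
  fix i assume "i < dim_vec ?\<eta>"
  then have i: "i < J - 1" by simp
  let ?d = "\<lambda>k. if k div p = i then x $ (k mod p) * \<delta> (k div p) $ (k mod p) else 0"
  let ?g = "\<lambda>k. ?Z $$ (i, k) * ?\<beta> $ k"
  have dim: "dim_row ?Z = J - 1" "dim_col ?Z = (J - 1) + (J - 1) * p"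
    "dim_vec ?\<beta> = (J - 1) + (J - 1) * p"
    using \<alpha> by (simp_all add: complete_design_def)
  have "(?Z *\<^sub>v ?\<beta>) $ i = (\<Sum>k<(J - 1) + (J - 1) * p. ?g k)"
    using i unfolding index_mult_mat_vec[OF i[folded dim(1)]] scalar_prod_def dim atLeast0LessThan
    by (intro sum.cong refl) (simp add: dim)
  also have "\<dots> = (\<Sum>k<J - 1. ?g k) + (\<Sum>k<(J - 1) * p. ?g (J - 1 + k))"
    by (rule sum_lessThan_add)
  also have "(\<Sum>k<J - 1. ?g k) = (\<Sum>k<J - 1. if k = i then \<alpha> $ k else 0)"
    using i \<alpha> by (intro sum.cong) (auto simp: complete_design_def)
  also have "\<dots> = \<alpha> $ i" using i by simp
  also have "(\<Sum>k<(J - 1) * p. ?g (J - 1 + k)) = (\<Sum>k<(J - 1) * p. ?d k)"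
    using i \<alpha> by (intro sum.cong) (auto simp: complete_design_def)
  also have "\<dots> = (\<Sum>k | k \<in> {..<(J - 1) * p} \<and> k div p = i.
      x $ (k mod p) * \<delta> (k div p) $ (k mod p))"
    by (rule sum.inter_filter[symmetric]) simp
  also have "\<dots> = (\<Sum>l<p. x $ l * \<delta> i $ l)"
  proof (rule sum.reindex_bij_witness[where i = "\<lambda>l. i * p + l" and j = "\<lambda>k. k mod p"])
    fix l assume "l \<in> {..<p}"
    then have l: "l < p" by simp
    have "i * p + l < Suc i * p" using l by simp
    also have "\<dots> \<le> (J - 1) * p" using i by (intro mult_le_mono1) simp
    finally show "i * p + l \<in> {k. k \<in> {..<(J - 1) * p} \<and> k div p = i}"
      using l by simp
  next
    fix k assume "k \<in> {k. k \<in> {..<(J - 1) * p} \<and> k div p = i}"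
    then have "0 < p" by (cases p) auto
    then show "k mod p \<in> {..<p}" by simp
  qed auto
  also have "\<dots> = x \<bullet> \<delta> i"
    using \<delta>[OF i] by (simp add: scalar_prod_def atLeast0LessThan)
  finally show "(?Z *\<^sub>v ?\<beta>) $ i = ?\<eta> $ i" using i by simp
qed (simp add: complete_design_def)

(* The definite descriptions in model_of (take sigma = id) and permuted_model_of are well
   defined for r = reference J and F = logistic. *)

lemma prob_simplex_iff:
  assumes "0 < J"
  shows "\<pi> \<in> prob_simplex J \<longleftrightarrow>
    \<pi> \<in> carrier_vec (J - 1) \<and> (\<forall>j\<in>{1..J}. 0 < cat_prob J \<pi> j)"
proof -
  have *: "{1..J} = insert J (Suc ` {..<J - 1})"
    using assms by (auto simp: image_Suc_lessThan)
  have "\<pi> $ i < 1" if "\<forall>i<J - 1. 0 < \<pi> $ i" "(\<Sum>i<J - 1. \<pi> $ i) < 1" "i < J - 1" for i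
  proof -
    have "\<pi> $ i \<le> (\<Sum>i<J - 1. \<pi> $ i)"
      using that by (intro member_le_sum) (auto simp: less_imp_le)
    with that(2) show ?thesis by simp
  qed
  moreover have "cat_prob J \<pi> (Suc i) = \<pi> $ i" if "i < J - 1" for i
    using that by (auto simp: cat_prob_def)
  moreover have "0 < cat_prob J \<pi> J \<longleftrightarrow> (\<Sum>i<J - 1. \<pi> $ i) < 1"
    by (simp add: cat_prob_def)
  ultimately show ?thesis
    unfolding prob_simplex_def * by (auto simp del: One_nat_def)
qed

lemma sum_cat_prob:
  assumes "0 < J"
  shows "(\<Sum>j\<in>{1..J}. cat_prob J \<pi> j) = 1"
proof -
  obtain n where J: "J = Suc n" using assms by (cases J) auto
  have "(\<Sum>j\<in>{1..n}. cat_prob J \<pi> j) = (\<Sum>i<n. \<pi> $ i)"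
    by (rule sum.reindex_bij_witness[where i = Suc and j = "\<lambda>j. j - 1"])
      (auto simp: J cat_prob_def)
  then show ?thesis by (simp add: J cat_prob_def)
qed

lemma cat_prob_permute:
  assumes J: "0 < J" and \<sigma>: "\<sigma> permutes {1..J}" and j: "j \<in> {1..J}"
  shows "cat_prob J (permute_probs J \<sigma> \<pi>) j = cat_prob J \<pi> (\<sigma> j)"
proof (cases "j = J")
  case True
  obtain n where n: "J = Suc n" using J by (cases J) auto
  have "1 = (\<Sum>j\<in>{1..J}. cat_prob J \<pi> (\<sigma> j))"
    using sum.permute[OF \<sigma>, of "cat_prob J \<pi>"] sum_cat_prob[OF J] by (simp add: comp_def)
  also have "\<dots> = (\<Sum>j\<in>{1..n}. cat_prob J \<pi> (\<sigma> j)) + cat_prob J \<pi> (\<sigma> J)"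
    by (simp add: n)
  also have "(\<Sum>j\<in>{1..n}. cat_prob J \<pi> (\<sigma> j)) = (\<Sum>i<n. cat_prob J \<pi> (\<sigma> (Suc i)))"
    by (rule sum.reindex_bij_witness[where i = Suc and j = "\<lambda>j. j - 1"]) auto
  finally have "cat_prob J \<pi> (\<sigma> J) = 1 - (\<Sum>i<n. cat_prob J \<pi> (\<sigma> (Suc i)))" by simp
  then show ?thesis
    unfolding True cat_prob_def[of _ "permute_probs J \<sigma> \<pi>"] by (simp add: permute_probs_def n)
next
  case False
  then have "j - 1 < J - 1" "Suc (j - 1) = j" using j by auto
  then show ?thesis
    using False unfolding cat_prob_def[of _ "permute_probs J \<sigma> \<pi>"] by (simp add: permute_probs_def)
qed

lemma reference_logistic_iff:
  assumes J: "0 < J" and \<pi>: "\<pi> \<in> prob_simplex J" and \<eta>: "\<eta> \<in> carrier_vec (J - 1)"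
  shows "reference J \<pi> = map_vec logistic \<eta> \<longleftrightarrow>
    (\<forall>i<J - 1. cat_prob J \<pi> (Suc i) = exp (\<eta> $ i) * cat_prob J \<pi> J)"
proof -
  have "cat_prob J \<pi> (Suc i) / (cat_prob J \<pi> (Suc i) + cat_prob J \<pi> J) = logistic (\<eta> $ i)
    \<longleftrightarrow> cat_prob J \<pi> (Suc i) = exp (\<eta> $ i) * cat_prob J \<pi> J" if i: "i < J - 1" for i
  proof -
    have "0 < cat_prob J \<pi> (Suc i)" "0 < cat_prob J \<pi> J"
      using \<pi> i J by (auto simp: prob_simplex_iff[OF J])
    moreover have "0 < 1 + exp (\<eta> $ i)" by (simp add: add_pos_pos)
    ultimately show ?thesis by (simp add: logistic_def frac_eq_eq algebra_simps)
  qed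
  then show ?thesis using \<eta> by (auto simp: reference_def vec_eq_iff)
qed

lemma reference_logistic_ex1:
  assumes J: "0 < J" and \<sigma>: "\<sigma> permutes {1..J}" and \<eta>: "\<eta> \<in> carrier_vec (J - 1)"
  shows "\<exists>!\<pi>. \<pi> \<in> prob_simplex J \<and> reference J (permute_probs J \<sigma> \<pi>) = map_vec logistic \<eta>"
proof -
  define T where "T = 1 + (\<Sum>i<J - 1. exp (\<eta> $ i))"
  have T: "T > 0" unfolding T_def by (simp add: add_pos_nonneg sum_nonneg)
  define w where "w j = (if j = J then 1 else exp (\<eta> $ (j - 1))) / T" for j
  have w_pos: "0 < w j" for j using T by (simp add: w_def)
  have in_simplex: "permute_probs J \<tau> \<pi> \<in> prob_simplex J"
    if "\<tau> permutes {1..J}" "\<pi> \<in> prob_simplex J" for \<tau> \<pi>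
    unfolding prob_simplex_iff[OF J]
  proof (intro conjI ballI)
    fix j assume j: "j \<in> {1..J}"
    then have "\<tau> j \<in> {1..J}" using permutes_in_image[OF that(1)] by blast
    then show "0 < cat_prob J (permute_probs J \<tau> \<pi>) j"
      using that(2) unfolding cat_prob_permute[OF J that(1) j] prob_simplex_iff[OF J] by blast
  qed (simp add: permute_probs_def)
  have key: "reference J \<pi> = map_vec logistic \<eta> \<longleftrightarrow> (\<forall>j\<in>{1..J}. cat_prob J \<pi> j = w j)"
    if \<pi>: "\<pi> \<in> prob_simplex J" for \<pi>
  proof -
    have *: "{1..J} = insert J (Suc ` {..<J - 1})" using J by (auto simp: image_Suc_lessThan)
    have wS: "w (Suc i) = exp (\<eta> $ i) * w J" if "i < J - 1" for i using that by (simp add: w_def)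
    have "cat_prob J \<pi> J = w J"
      if "\<forall>i<J - 1. cat_prob J \<pi> (Suc i) = exp (\<eta> $ i) * cat_prob J \<pi> J"
    proof -
      have "(\<Sum>i<J - 1. \<pi> $ i) = (\<Sum>i<J - 1. exp (\<eta> $ i) * cat_prob J \<pi> J)"
      proof (rule sum.cong)
        fix i assume i: "i \<in> {..<J - 1}"
        then have "Suc i \<noteq> J" by auto
        with i show "\<pi> $ i = exp (\<eta> $ i) * cat_prob J \<pi> J"
          using that[rule_format, of i] unfolding cat_prob_def[of J \<pi> "Suc i"] by simp
      qed simp
      also have "\<dots> = (T - 1) * cat_prob J \<pi> J"
        unfolding T_def sum_distrib_right[symmetric] by simp
      finally have "cat_prob J \<pi> J = 1 - (T - 1) * cat_prob J \<pi> J"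
        unfolding cat_prob_def[of J \<pi> J] by simp
      then have "cat_prob J \<pi> J * T = 1" by (simp add: algebra_simps)
      then show ?thesis using T by (simp add: w_def field_simps)
    qed
    then show ?thesis
      unfolding reference_logistic_iff[OF J \<pi> \<eta>] *
      by (simp only: ball_simps lessThan_iff) (metis wS lessThan_iff)
  qed
  have perm: "reference J (permute_probs J \<sigma> \<pi>) = map_vec logistic \<eta> \<longleftrightarrow>
      (\<forall>j\<in>{1..J}. cat_prob J \<pi> (\<sigma> j) = w j)" if "\<pi> \<in> prob_simplex J" for \<pi>
    using key[OF in_simplex[OF \<sigma> that]] cat_prob_permute[OF J \<sigma>] by auto
  define \<pi>0 where "\<pi>0 = vec (J - 1) (\<lambda>i. w (Suc i))"
  have "(\<Sum>i<J - 1. w (Suc i)) = (\<Sum>i<J - 1. exp (\<eta> $ i) / T)"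
    by (rule sum.cong) (auto simp: w_def)
  also have "\<dots> = 1 - w J"
    using T by (simp add: w_def T_def sum_divide_distrib[symmetric] field_simps)
  finally have \<pi>0: "cat_prob J \<pi>0 j = w j" if "j \<in> {1..J}" for j
    using that by (auto simp: cat_prob_def \<pi>0_def)
  then have \<pi>0S: "\<pi>0 \<in> prob_simplex J"
    using w_pos by (simp add: prob_simplex_iff[OF J] \<pi>0_def)
  define \<tau> where "\<tau> = inv_into UNIV \<sigma>"
  note inv\<sigma> = permutes_inv[OF \<sigma>, folded \<tau>_def]
  show ?thesis
  proof (rule ex1I[of _ "permute_probs J \<tau> \<pi>0"], intro conjI)
    show S: "permute_probs J \<tau> \<pi>0 \<in> prob_simplex J"
      by (rule in_simplex[OF inv\<sigma> \<pi>0S])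
    show "reference J (permute_probs J \<sigma> (permute_probs J \<tau> \<pi>0)) = map_vec logistic \<eta>"
      unfolding perm[OF S] using \<pi>0 cat_prob_permute[OF J inv\<sigma>] permutes_in_image[OF \<sigma>]
      by (simp add: permutes_inverses[OF \<sigma>, folded \<tau>_def] del: atLeastAtMost_iff)
  next
    fix \<pi> assume A: "\<pi> \<in> prob_simplex J \<and> reference J (permute_probs J \<sigma> \<pi>) = map_vec logistic \<eta>"
    then have *: "cat_prob J \<pi> (\<sigma> j) = w j" if "j \<in> {1..J}" for j using perm that by blast
    show "\<pi> = permute_probs J \<tau> \<pi>0"
    proof (rule eq_vecI)
      fix i assume "i < dim_vec (permute_probs J \<tau> \<pi>0)"
      then have i: "i < J - 1" by (simp add: permute_probs_def)
      then have ne: "Suc i \<noteq> J" by auto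
      from i have "Suc i \<in> {1..J}" by auto
      then have "\<tau> (Suc i) \<in> {1..J}" using permutes_in_image[OF inv\<sigma>] by blast
      from *[OF this] \<pi>0[OF this] show "\<pi> $ i = permute_probs J \<tau> \<pi>0 $ i"
        using i ne by (simp add: permutes_inverses[OF \<sigma>, folded \<tau>_def] permute_probs_def cat_prob_def[of _ \<pi>])
    qed (use A in \<open>auto simp: permute_probs_def prob_simplex_def\<close>)
  qed
qed

lemma permute_probs_id:
  assumes "\<pi> \<in> prob_simplex J"
  shows "permute_probs J id \<pi> = \<pi>"
  using assms by (auto simp: permute_probs_def prob_simplex_def cat_prob_def)

end

(* For the reference ratio and the logistic cdf, eta lists the log odds of the categories against
   category J. Permuting the categories changes the reference category, hence replaces eta by A eta
   for an invertible matrix A of differences that does not depend on x. Since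
   A Z_c(x) = Z_c(x) (A tensor I), with A acting alike on the intercepts and on the coefficients of
   each covariate, the permuted model with matrix C is the unpermuted model with matrix
   (A tensor I) C, which has full column rank again. The map C -> (A tensor I) C is invertible, and
   this gives stability. *)
theory Submission
  imports Defs
begin

section \<open>Full column rank\<close>

text \<open>The rank is the size of a maximal independent set of columns, and a repeated column
  would leave fewer than \<open>nc\<close> candidates.\<close>

lemma (in vec_space) distinct_cols_if_full_rank:
  assumes A: "A \<in> carrier_mat n nc" and rank: "rank A = nc"
  shows "distinct (cols A)"
proof -
  obtain S where S: "maximal S (\<lambda>T. T \<subseteq> set (cols A) \<and> lin_indpt T)"
    using maximal_exists[of "\<lambda>T. T \<subseteq> set (cols A) \<and> lin_indpt T" "card (set (cols A))" "{}"]
    by (meson List.finite_set card_mono empty_iff empty_subsetI finite_lin_indpt2 rev_finite_subset)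
  then have "nc \<le> card (set (cols A))"
    using rank_card_indpt[OF A S] rank by (auto simp: maximal_def intro: card_mono)
  moreover have "card (set (cols A)) \<le> nc"
    using card_length[of "cols A"] A by simp
  ultimately show ?thesis
    using A by (intro card_distinct) simp
qed

text \<open>Independence concerns the set of columns, so it expresses a trivial kernel only once the
  columns are known to be distinct; both directions establish this first.\<close>

lemma (in vec_space) full_column_rank_iff:
  assumes A: "A \<in> carrier_mat n nc"
  shows "rank A = nc \<longleftrightarrow> (\<forall>v\<in>carrier_vec nc. A *\<^sub>v v = 0\<^sub>v n \<longrightarrow> v = 0\<^sub>v nc)"
proof
  assume rank: "rank A = nc"
  note distinct = distinct_cols_if_full_rank[OF A rank]
  show "\<forall>v\<in>carrier_vec nc. A *\<^sub>v v = 0\<^sub>v n \<longrightarrow> v = 0\<^sub>v nc"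
    using lin_depI[OF A _ _ _ distinct] full_rank_lin_indpt[OF A rank distinct] by blast
next
  assume inj: "\<forall>v\<in>carrier_vec nc. A *\<^sub>v v = 0\<^sub>v n \<longrightarrow> v = 0\<^sub>v nc"
  have distinct: "distinct (cols A)"
  proof (rule ccontr)
    assume "\<not> distinct (cols A)"
    then obtain i j where ij: "i \<noteq> j" "i < nc" "j < nc" "col A i = col A j"
      using A by (auto simp: distinct_conv_nth)
    \<comment> \<open>Two equal columns put this nonzero vector into the kernel.\<close>
    let ?v = "unit_vec nc i - unit_vec nc j :: 'a vec"
    have "A *\<^sub>v ?v = A *\<^sub>v unit_vec nc i - A *\<^sub>v unit_vec nc j"
      using A by (intro mult_minus_distrib_mat_vec) auto
    also have "\<dots> = col A i - col A j"
      using ij col_mult2[OF A one_carrier_mat] A by simp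
    also have "\<dots> = 0\<^sub>v n" using ij A by auto
    finally have "?v = 0\<^sub>v nc" using inj by simp
    then have "?v $ i = 0\<^sub>v nc $ i" by simp
    then show False using ij by simp
  qed
  show "rank A = nc"
    using lin_indpt_full_rank[OF A distinct] lin_depE[OF A _ distinct] inj by blast
qed

text \<open>\<open>A\<close> is a left inverse of \<open>B\<close>, so a kernel vector of
  \<open>B * C\<close> is already one of \<open>C\<close>.\<close>

lemma full_column_rank_mult_left:
  fixes A B C :: "real mat"
  assumes A: "A \<in> carrier_mat n n" and B: "B \<in> carrier_mat n n" and AB: "A * B = 1\<^sub>m n"
    and C: "C \<in> carrier_mat n q" and rank: "vec_space.rank n C = q"
  shows "vec_space.rank n (B * C) = q"
proof -
  have "v = 0\<^sub>v q" if v: "v \<in> carrier_vec q" and 0: "(B * C) *\<^sub>v v = 0\<^sub>v n" for v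
  proof -
    have "C *\<^sub>v v = (A * B * C) *\<^sub>v v" using C by (simp add: AB)
    also have "\<dots> = A *\<^sub>v ((B * C) *\<^sub>v v)"
      using A B C v by (simp add: assoc_mult_mat[OF A B C] assoc_mult_mat_vec[of _ n n _ q])
    also have "\<dots> = 0\<^sub>v n" using A by (auto simp: 0 scalar_prod_def)
    finally show ?thesis
      using rank v unfolding vec_space.full_column_rank_iff[OF C] by blast
  qed
  then show ?thesis
    using B C by (subst vec_space.full_column_rank_iff[of _ _ q]) auto
qed

section \<open>Change of the reference category\<close>

text \<open>The reference category \<open>J\<close> gets the linear predictor \<open>0\<close>, its log odds against itself.\<close>

definition predictor :: "nat \<Rightarrow> real vec \<Rightarrow> nat \<Rightarrow> real" where
  "predictor J \<eta> j = (if j = J then 0 else \<eta> $ (j - 1))"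

text \<open>The matrix turns log odds against category \<open>J\<close> into log odds against
  category \<open>\<tau> J\<close>, listed in the order given by \<tau>. Category \<open>J\<close>
  has predictor 0 and needs no column.\<close>

definition rereference :: "nat \<Rightarrow> (nat \<Rightarrow> nat) \<Rightarrow> real mat" where
  "rereference J \<tau> = mat (J - 1) (J - 1)
     (\<lambda>(i, k). of_bool (\<tau> (Suc i) = Suc k) - of_bool (\<tau> J = Suc k))"

lemma rereference_carrier [simp]: "rereference J \<tau> \<in> carrier_mat (J - 1) (J - 1)"
  by (simp add: rereference_def)

text \<open>\<open>Suc k\<close> never reaches \<open>J\<close>, so \<open>t = J\<close> selects
  nothing. When \<open>f\<close> lists the entries of a vector, the result is its
  \<open>predictor\<close> at \<open>t\<close>.\<close>

lemma sum_of_bool_category: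
  fixes f :: "nat \<Rightarrow> real"
  assumes "t \<in> {1..J}"
  shows "(\<Sum>k<J - 1. of_bool (t = Suc k) * f k) = (if t = J then 0 else f (t - 1))"
proof -
  have "(\<Sum>k<J - 1. of_bool (t = Suc k) * f k) = (\<Sum>k<J - 1. if k = t - 1 then f k else 0)"
    using assms by (intro sum.cong) auto
  also have "\<dots> = (if t - 1 < J - 1 then f (t - 1) else 0)" by simp
  finally show ?thesis using assms by auto
qed

lemma rereference_mult_vec:
  assumes \<tau>: "\<tau> permutes {1..J}" and J: "0 < J" and \<eta>: "\<eta> \<in> carrier_vec (J - 1)" and i: "i < J - 1"
  shows "(rereference J \<tau> *\<^sub>v \<eta>) $ i = predictor J \<eta> (\<tau> (Suc i)) - predictor J \<eta> (\<tau> J)"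
proof -
  have mem: "\<tau> (Suc i) \<in> {1..J}" "\<tau> J \<in> {1..J}"
    using permutes_in_image[OF \<tau>] J i by auto
  have "(rereference J \<tau> *\<^sub>v \<eta>) $ i =
      (\<Sum>k<J - 1. of_bool (\<tau> (Suc i) = Suc k) * \<eta> $ k - of_bool (\<tau> J = Suc k) * \<eta> $ k)"
    using i \<eta> by (simp add: rereference_def scalar_prod_def atLeast0LessThan left_diff_distrib)
  then show ?thesis
    unfolding sum_subtractf sum_of_bool_category[OF mem(1)] sum_of_bool_category[OF mem(2)]
    by (simp add: predictor_def)
qed

text \<open>The terms at \<open>\<rho> J\<close> cancel in the differences. The composition is
  reversed because each matrix substitutes its permutation into the index of the predictor.\<close>

lemma rereference_mult:
  assumes \<tau>: "\<tau> permutes {1..J}" and J: "0 < J"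
  shows "rereference J \<tau> * rereference J \<rho> = rereference J (\<rho> \<circ> \<tau>)"
proof (rule eq_matI)
  fix i l assume "i < dim_row (rereference J (\<rho> \<circ> \<tau>))" "l < dim_col (rereference J (\<rho> \<circ> \<tau>))"
  then have il: "i < J - 1" "l < J - 1" by (auto simp: rereference_def)
  then have mem: "\<tau> (Suc i) \<in> {1..J}" "\<tau> J \<in> {1..J}"
    using permutes_in_image[OF \<tau>] J by auto
  \<comment> \<open>At category \<open>J\<close> this difference would be 0, which is the value that
    \<open>sum_of_bool_category\<close> yields there.\<close>
  let ?r = "\<lambda>k. of_bool (\<rho> (Suc k) = Suc l) - of_bool (\<rho> J = Suc l) :: real"
  have "(rereference J \<tau> * rereference J \<rho>) $$ (i, l) =
      (\<Sum>k<J - 1. of_bool (\<tau> (Suc i) = Suc k) * ?r k - of_bool (\<tau> J = Suc k) * ?r k)"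
    using il by (simp add: rereference_def scalar_prod_def atLeast0LessThan left_diff_distrib)
  then show "(rereference J \<tau> * rereference J \<rho>) $$ (i, l) = rereference J (\<rho> \<circ> \<tau>) $$ (i, l)"
    unfolding sum_subtractf sum_of_bool_category[OF mem(1)] sum_of_bool_category[OF mem(2)]
    using il mem by (auto simp: rereference_def)
qed (auto simp: rereference_def)

lemma rereference_id: "rereference J id = 1\<^sub>m (J - 1)"
  by (rule eq_matI) (auto simp: rereference_def)

section \<open>Reference equations as proportionality of probabilities\<close>

lemma permute_probs_in_simplex:
  assumes J: "0 < J" and \<sigma>: "\<sigma> permutes {1..J}" and \<pi>: "\<pi> \<in> prob_simplex J"
  shows "permute_probs J \<sigma> \<pi> \<in> prob_simplex J"
  unfolding prob_simplex_iff[OF J]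
proof (intro conjI ballI)
  fix j assume j: "j \<in> {1..J}"
  then have "\<sigma> j \<in> {1..J}" using permutes_in_image[OF \<sigma>] by blast
  then show "0 < cat_prob J (permute_probs J \<sigma> \<pi>) j"
    using \<pi> unfolding cat_prob_permute[OF J \<sigma> j] prob_simplex_iff[OF J] by blast
qed (simp add: permute_probs_def)

lemma ball_category_iff:
  assumes "0 < J"
  shows "(\<forall>j\<in>{1..J}. P j) \<longleftrightarrow> (\<forall>i<J - 1. P (Suc i)) \<and> P J"
proof -
  have "{1..J} = insert J (Suc ` {..<J - 1})"
    using assms by (auto simp: image_Suc_lessThan)
  then show ?thesis by auto
qed

text \<open>The added case \<open>j = J\<close> has factor \<open>exp 0\<close> and is trivial; with
  it the system ranges over all categories and can be reindexed by a permutation.\<close>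

lemma reference_logistic_predictor_iff:
  assumes J: "0 < J" and \<pi>: "\<pi> \<in> prob_simplex J" and \<eta>: "\<eta> \<in> carrier_vec (J - 1)"
  shows "reference J \<pi> = map_vec logistic \<eta> \<longleftrightarrow>
    (\<forall>j\<in>{1..J}. cat_prob J \<pi> j = exp (predictor J \<eta> j) * cat_prob J \<pi> J)"
  unfolding reference_logistic_iff[OF J \<pi> \<eta>] ball_category_iff[OF J]
  by (auto simp: predictor_def)

text \<open>At \<open>j = J\<close> both sides are 0, so the formula for the rows extends to the
  reference category.\<close>

lemma predictor_rereference:
  assumes \<tau>: "\<tau> permutes {1..J}" and J: "0 < J" and \<eta>: "\<eta> \<in> carrier_vec (J - 1)"
    and j: "j \<in> {1..J}"
  shows "predictor J (rereference J \<tau> *\<^sub>v \<eta>) j = predictor J \<eta> (\<tau> j) - predictor J \<eta> (\<tau> J)"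
proof (cases "j = J")
  case False
  then have "j - 1 < J - 1" "Suc (j - 1) = j" using j by auto
  with rereference_mult_vec[OF \<tau> J \<eta>, of "j - 1"] False show ?thesis
    by (simp add: predictor_def[of J _ j])
qed (simp add: predictor_def[of J "rereference J \<tau> *\<^sub>v \<eta>"])

text \<open>With \<tau> the inverse of \<sigma>, both sides say that the probability of
  \<open>k\<close> is proportional to \<open>exp (predictor J \<eta> (\<tau> k))\<close>. They
  differ only in the category used for normalisation: \<open>\<sigma> J\<close> on the left,
  \<open>J\<close> on the right.\<close>

lemma reference_permute_iff:
  assumes J: "0 < J" and \<sigma>: "\<sigma> permutes {1..J}" and \<pi>: "\<pi> \<in> prob_simplex J"
    and \<eta>: "\<eta> \<in> carrier_vec (J - 1)"
  shows "reference J (permute_probs J \<sigma> \<pi>) = map_vec logistic \<eta> \<longleftrightarrow>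
    reference J \<pi> = map_vec logistic (rereference J (inv_into UNIV \<sigma>) *\<^sub>v \<eta>)"
proof -
  let ?c = "cat_prob J \<pi>" and ?e = "predictor J \<eta>" and ?\<tau> = "inv_into UNIV \<sigma>"
  note \<tau> = permutes_inv[OF \<sigma>]
  have JJ: "J \<in> {1..J}" using J by simp
  have e_J: "?e J = 0" by (simp add: predictor_def)
  have \<eta>': "rereference J ?\<tau> *\<^sub>v \<eta> \<in> carrier_vec (J - 1)"
    by (rule mult_mat_vec_carrier[OF rereference_carrier \<eta>])
  have "reference J (permute_probs J \<sigma> \<pi>) = map_vec logistic \<eta> \<longleftrightarrow>
      (\<forall>j\<in>{1..J}. ?c (\<sigma> j) = exp (?e j) * ?c (\<sigma> J))"
    unfolding reference_logistic_predictor_iff[OF J permute_probs_in_simplex[OF J \<sigma> \<pi>] \<eta>]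
      cat_prob_permute[OF J \<sigma> JJ]
    by (intro ball_cong refl) (simp only: cat_prob_permute[OF J \<sigma>])
  also have "\<dots> \<longleftrightarrow> (\<forall>k\<in>{1..J}. ?c k = exp (?e (?\<tau> k) - ?e (?\<tau> J)) * ?c J)"
  proof (intro iffI ballI)
    fix k assume *: "\<forall>j\<in>{1..J}. ?c (\<sigma> j) = exp (?e j) * ?c (\<sigma> J)" and k: "k \<in> {1..J}"
    have "?c k = exp (?e (?\<tau> k)) * ?c (\<sigma> J)" if "k \<in> {1..J}" for k
      using *[rule_format, of "?\<tau> k"] that permutes_in_image[OF \<tau>, of k]
      by (simp add: permutes_inverses[OF \<sigma>])
    \<comment> \<open>The instance at \<open>J\<close> expresses \<open>?c (\<sigma> J)\<close>
      through \<open>?c J\<close>.\<close>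
    from this[OF k] this[OF JJ] show "?c k = exp (?e (?\<tau> k) - ?e (?\<tau> J)) * ?c J"
      by (simp add: exp_diff)
  next
    fix j assume *: "\<forall>k\<in>{1..J}. ?c k = exp (?e (?\<tau> k) - ?e (?\<tau> J)) * ?c J" and j: "j \<in> {1..J}"
    have "?c (\<sigma> j) = exp (?e j - ?e (?\<tau> J)) * ?c J" if "j \<in> {1..J}" for j
      using *[rule_format, of "\<sigma> j"] that permutes_in_image[OF \<sigma>, of j]
      by (simp add: permutes_inverses[OF \<sigma>])
    \<comment> \<open>Since \<open>?e J = 0\<close>, the instance at \<open>J\<close> reads
      \<open>?c (\<sigma> J) = exp (- ?e (?\<tau> J)) * ?c J\<close>.\<close>
    from this[OF j] this[OF JJ] show "?c (\<sigma> j) = exp (?e j) * ?c (\<sigma> J)"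
      by (simp add: diff_conv_add_uminus exp_add e_J del: add_uminus_conv_diff)
  qed
  also have "\<dots> \<longleftrightarrow> reference J \<pi> = map_vec logistic (rereference J ?\<tau> *\<^sub>v \<eta>)"
    unfolding reference_logistic_predictor_iff[OF J \<pi> \<eta>']
    by (simp add: predictor_rereference[OF \<tau> J \<eta>] del: atLeastAtMost_iff)
  finally show ?thesis .
qed

section \<open>The induced change of parameters\<close>

text \<open>Parameter \<open>k\<close> belongs to category \<open>Suc (category n p k)\<close>, where \<open>n = J - 1\<close>; it is the intercept
  if \<open>covariate n p k = 0\<close> and the coefficient of \<open>x $ m\<close> if \<open>covariate n p k = Suc m\<close>.\<close>

definition category :: "nat \<Rightarrow> nat \<Rightarrow> nat \<Rightarrow> nat" where
  "category n p k = (if k < n then k else (k - n) div p)"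

definition covariate :: "nat \<Rightarrow> nat \<Rightarrow> nat \<Rightarrow> nat" where
  "covariate n p k = (if k < n then 0 else Suc ((k - n) mod p))"

text \<open>Inverse of the numbering by category and covariate; \<open>m - 1\<close> is the position
  in \<open>x\<close>, as \<open>m = 0\<close> stands for the intercept.\<close>

definition param_index :: "nat \<Rightarrow> nat \<Rightarrow> nat \<Rightarrow> nat \<Rightarrow> nat" where
  "param_index n p c m = (if m = 0 then c else n + (c * p + (m - 1)))"

lemma category_less:
  assumes "k < n * (1 + p)"
  shows "category n p k < n"
  using assms by (auto simp: category_def less_mult_imp_div_less)

lemma covariate_less:
  assumes "k < n * (1 + p)"
  shows "covariate n p k < Suc p"
  using assms by (cases p) (auto simp: covariate_def)

lemma param_index_category_covariate:
  "param_index n p (category n p k) (covariate n p k) = k"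
  by (auto simp: param_index_def category_def covariate_def)

lemma category_param_index:
  assumes "c < n" "m < Suc p"
  shows "category n p (param_index n p c m) = c"
  using assms by (cases m) (auto simp: param_index_def category_def)

lemma covariate_param_index:
  assumes "c < n" "m < Suc p"
  shows "covariate n p (param_index n p c m) = m"
  using assms by (cases m) (auto simp: param_index_def covariate_def)

lemma param_index_less:
  assumes "c < n" "m < Suc p"
  shows "param_index n p c m < n * (1 + p)"
proof (cases "m = 0")
  case True
  then show ?thesis using assms by (simp add: param_index_def)
next
  case False
  have "c * p + (m - 1) < Suc c * p" using assms False by simp
  also have "\<dots> \<le> n * p" using assms by (intro mult_le_mono1) simp
  finally show ?thesis using False by (simp add: param_index_def)
qed

text \<open>Serves to split matrix products over parameters into sums over categories and
  covariates, where an indicator collapses the sum over covariates.\<close>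

lemma sum_param_index:
  fixes f :: "nat \<Rightarrow> real"
  shows "(\<Sum>k<n * (1 + p). f k) = (\<Sum>c<n. \<Sum>m<Suc p. f (param_index n p c m))"
  unfolding sum.cartesian_product
proof (rule sum.reindex_bij_witness[where i = "\<lambda>(c, m). param_index n p c m"
      and j = "\<lambda>k. (category n p k, covariate n p k)"])
  fix k assume "k \<in> {..<n * (1 + p)}"
  then have k: "k < n * (1 + p)" by (simp only: lessThan_iff)
  show "(category n p k, covariate n p k) \<in> {..<n} \<times> {..<Suc p}"
    using category_less[OF k] covariate_less[OF k] by simp
next
  fix cm assume "cm \<in> {..<n} \<times> {..<Suc p}"
  then obtain c m where cm: "cm = (c, m)" "c < n" "m < Suc p" by auto
  show "(case cm of (c, m) \<Rightarrow> param_index n p c m) \<in> {..<n * (1 + p)}"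
    using param_index_less[OF cm(2,3)] by (simp only: cm(1) prod.case lessThan_iff)
  show "(category n p (case cm of (c, m) \<Rightarrow> param_index n p c m),
      covariate n p (case cm of (c, m) \<Rightarrow> param_index n p c m)) = cm"
    by (simp only: cm(1) prod.case category_param_index[OF cm(2,3)] covariate_param_index[OF cm(2,3)])
qed (simp_all add: param_index_category_covariate)

text \<open>The Kronecker product of \<open>A\<close> with the identity of size
  \<open>1 + p\<close>, in the parameter order that lists all intercepts first.\<close>

definition blockwise :: "nat \<Rightarrow> nat \<Rightarrow> real mat \<Rightarrow> real mat" where
  "blockwise n p A = mat (n * (1 + p)) (n * (1 + p)) (\<lambda>(k, l).
     of_bool (covariate n p k = covariate n p l) * A $$ (category n p k, category n p l))"

lemma blockwise_carrier [simp]: "blockwise n p A \<in> carrier_mat (n * (1 + p)) (n * (1 + p))"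
  by (simp add: blockwise_def)

lemma blockwise_index:
  assumes "k < n * (1 + p)" "l < n * (1 + p)"
  shows "blockwise n p A $$ (k, l) =
    of_bool (covariate n p k = covariate n p l) * A $$ (category n p k, category n p l)"
  using assms by (simp add: blockwise_def)

lemma blockwise_mult:
  assumes A: "A \<in> carrier_mat n n" and B: "B \<in> carrier_mat n n"
  shows "blockwise n p A * blockwise n p B = blockwise n p (A * B)"
proof (rule eq_matI)
  let ?N = "n * (1 + p)" and ?cat = "category n p" and ?cov = "covariate n p"
  fix k l assume "k < dim_row (blockwise n p (A * B))" "l < dim_col (blockwise n p (A * B))"
  then have kl: "k < ?N" "l < ?N" by (auto simp: blockwise_def)
  note cat = category_less[OF kl(1)] category_less[OF kl(2)]
  \<comment> \<open>The two indicators compare \<open>m\<close> with \<open>?cov k\<close> and with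
    \<open>?cov l\<close>; the second is rewritten free of \<open>m\<close>, so that the sum over
    \<open>m\<close> has a single term.\<close>
  let ?f = "\<lambda>c m. of_bool (m = ?cov k) *
    (of_bool (?cov k = ?cov l) * (A $$ (?cat k, c) * B $$ (c, ?cat l)))"
  have "(blockwise n p A * blockwise n p B) $$ (k, l) =
      (\<Sum>i<?N. blockwise n p A $$ (k, i) * blockwise n p B $$ (i, l))"
    using kl by (simp add: blockwise_def scalar_prod_def atLeast0LessThan)
  also have "\<dots> = (\<Sum>c<n. \<Sum>m<Suc p. ?f c m)"
    unfolding sum_param_index
  proof (intro sum.cong refl)
    fix c m assume "c \<in> {..<n}" "m \<in> {..<Suc p}"
    then have cm: "c < n" "m < Suc p" by auto
    show "blockwise n p A $$ (k, param_index n p c m) * blockwise n p B $$ (param_index n p c m, l) = ?f c m"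
      unfolding blockwise_index[OF kl(1) param_index_less[OF cm]]
        blockwise_index[OF param_index_less[OF cm] kl(2)]
        category_param_index[OF cm] covariate_param_index[OF cm]
      by auto
  qed
  also have "\<dots> = (\<Sum>c<n. of_bool (?cov k = ?cov l) * (A $$ (?cat k, c) * B $$ (c, ?cat l)))"
    using covariate_less[OF kl(1)]
    by (intro sum.cong refl) (simp add: sum_distrib_right[symmetric] of_bool_def del: sum.lessThan_Suc)
  also have "\<dots> = blockwise n p (A * B) $$ (k, l)"
    using kl cat A B by (simp add: blockwise_def scalar_prod_def atLeast0LessThan)
  finally show "(blockwise n p A * blockwise n p B) $$ (k, l) = blockwise n p (A * B) $$ (k, l)" .
qed (auto simp: blockwise_def)

lemma blockwise_one: "blockwise n p (1\<^sub>m n) = 1\<^sub>m (n * (1 + p))"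
proof (rule eq_matI)
  fix k l assume "k < dim_row (1\<^sub>m (n * (1 + p)))" "l < dim_col (1\<^sub>m (n * (1 + p)))"
  then have kl: "k < n * (1 + p)" "l < n * (1 + p)" by auto
  \<comment> \<open>Category and covariate together determine the parameter, so only diagonal
    entries survive.\<close>
  have "k = l" if "category n p k = category n p l" "covariate n p k = covariate n p l"
    using that by (metis param_index_category_covariate)
  then show "blockwise n p (1\<^sub>m n) $$ (k, l) = 1\<^sub>m (n * (1 + p)) $$ (k, l)"
    using kl category_less[OF kl(1)] category_less[OF kl(2)] by (auto simp: blockwise_def)
qed (auto simp: blockwise_def)

section \<open>Action on the complete design\<close>

lemma complete_design_carrier [simp]:
  "complete_design J p x \<in> carrier_mat (J - 1) ((J - 1) * (1 + p))"
  by (simp add: complete_design_def)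

text \<open>With the constant 1 as covariate 0, intercepts and slopes obey one formula: up to column
  order the matrix is I tensor (1, x^t).\<close>

lemma complete_design_index:
  assumes "i < J - 1" "k < (J - 1) * (1 + p)"
  shows "complete_design J p x $$ (i, k) = of_bool (category (J - 1) p k = i) *
    (case covariate (J - 1) p k of 0 \<Rightarrow> 1 | Suc m \<Rightarrow> x $ m)"
  using assms by (auto simp: complete_design_def category_def covariate_def)

text \<open>Both products are A tensor (1, x^t) up to column order: the entry at
  \<open>(i, l)\<close> is the covariate of \<open>l\<close> times the entry of \<open>A\<close> at
  \<open>i\<close> and the category of \<open>l\<close>.\<close>

lemma complete_design_blockwise:
  assumes A: "A \<in> carrier_mat (J - 1) (J - 1)"
  shows "complete_design J p x * blockwise (J - 1) p A = A * complete_design J p x"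
proof (rule eq_matI)
  let ?n = "J - 1" and ?N = "(J - 1) * (1 + p)"
  let ?cat = "category ?n p" and ?cov = "covariate ?n p"
  let ?x = "\<lambda>m. case m of 0 \<Rightarrow> 1 | Suc m \<Rightarrow> x $ m"
  let ?Z = "complete_design J p x"
  fix i l assume "i < dim_row (A * ?Z)" "l < dim_col (A * ?Z)"
  then have il: "i < ?n" "l < ?N" using A by (auto simp: complete_design_def)
  note dims = carrier_matD[OF A] carrier_matD[OF complete_design_carrier[of J p x]]
    carrier_matD[OF blockwise_carrier[of ?n p A]]
  have "(?Z * blockwise ?n p A) $$ (i, l) = (\<Sum>k<?N. ?Z $$ (i, k) * blockwise ?n p A $$ (k, l))"
    using il dims by (simp add: scalar_prod_def atLeast0LessThan del: mult_Suc_right One_nat_def add_Suc)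
  also have "\<dots> = (\<Sum>c<?n. \<Sum>m<Suc p. of_bool (m = ?cov l) * (of_bool (c = i) * (?x m * A $$ (c, ?cat l))))"
    unfolding sum_param_index
  proof (intro sum.cong refl)
    fix c m assume "c \<in> {..<?n}" "m \<in> {..<Suc p}"
    then have cm: "c < ?n" "m < Suc p" by auto
    show "?Z $$ (i, param_index ?n p c m) * blockwise ?n p A $$ (param_index ?n p c m, l) =
        of_bool (m = ?cov l) * (of_bool (c = i) * (?x m * A $$ (c, ?cat l)))"
      unfolding complete_design_index[OF il(1) param_index_less[OF cm]]
        blockwise_index[OF param_index_less[OF cm] il(2)]
        category_param_index[OF cm] covariate_param_index[OF cm]
      by auto
  qed
  also have "\<dots> = (\<Sum>c<?n. of_bool (c = i) * (?x (?cov l) * A $$ (c, ?cat l)))"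
    using covariate_less[OF il(2)]
    by (intro sum.cong refl) (simp add: of_bool_def if_distrib[of "\<lambda>b. b * _"] cong: if_cong del: sum.lessThan_Suc)
  also have "\<dots> = ?x (?cov l) * A $$ (i, ?cat l)"
    using il by (simp add: of_bool_def if_distrib[of "\<lambda>b. b * _"] cong: if_cong)
  \<comment> \<open>The single term is spread into a sum again, to be read as an entry of
    \<open>A * ?Z\<close>.\<close>
  also have "\<dots> = (\<Sum>c<?n. of_bool (c = ?cat l) * (?x (?cov l) * A $$ (i, c)))"
    using category_less[OF il(2)] by (simp add: of_bool_def if_distrib[of "\<lambda>b. b * _"] cong: if_cong)
  also have "\<dots> = (\<Sum>c<?n. A $$ (i, c) * ?Z $$ (c, l))"
    using il by (intro sum.cong refl) (auto simp: complete_design_index)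
  also have "\<dots> = (A * ?Z) $$ (i, l)"
    using il by (simp add: dims scalar_prod_def atLeast0LessThan)
  finally show "(?Z * blockwise ?n p A) $$ (i, l) = (A * ?Z) $$ (i, l)" .
qed (use A in \<open>auto simp: complete_design_def blockwise_def\<close>)

section \<open>Stability\<close>

context
  fixes J p :: nat and X :: "real vec set" and \<sigma> :: "nat \<Rightarrow> nat"
  assumes J: "0 < J" and X: "X \<noteq> {}" and \<sigma>: "\<sigma> permutes {1..J}"
begin

abbreviation "n_params \<equiv> (J - 1) * (1 + p)"
abbreviation "R \<tau> \<equiv> blockwise (J - 1) p (rereference J \<tau>)"

text \<open>The first identity preserves the rank under \<open>R (inv_into UNIV \<sigma>)\<close>;
  the second preserves it under \<open>R \<sigma>\<close> and recovers \<open>C\<close> from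
  \<open>R \<sigma> * C\<close>.\<close>

lemma blockwise_rereference_inverse:
  "R \<sigma> * R (inv_into UNIV \<sigma>) = 1\<^sub>m n_params" "R (inv_into UNIV \<sigma>) * R \<sigma> = 1\<^sub>m n_params"
  by (simp_all only: blockwise_mult[OF rereference_carrier rereference_carrier]
      rereference_mult[OF \<sigma> J] rereference_mult[OF permutes_inv[OF \<sigma>] J]
      permutes_inv_o[OF \<sigma>] rereference_id blockwise_one)

text \<open>Moving the factor \<open>R\<close> across the complete design turns it into
  \<open>rereference\<close> applied to the linear predictor, which is the change made by
  \<open>reference_permute_iff\<close>. The number of columns stays \<open>q\<close>, so the
  parameter spaces agree.\<close>

lemma permuted_model_eq:
  assumes C: "C \<in> carrier_mat n_params q"
  shows "model_eq X
    (permuted_model_of J X \<sigma> (reference J, logistic, \<lambda>x. complete_design J p x * C))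
    (model_of J X (reference J, logistic, \<lambda>x. complete_design J p x * (R (inv_into UNIV \<sigma>) * C)))"
proof -
  let ?\<tau> = "inv_into UNIV \<sigma>"
  let ?Z = "\<lambda>x. complete_design J p x"
  have RC: "R ?\<tau> * C \<in> carrier_mat n_params q"
    by (rule mult_carrier_mat[OF blockwise_carrier C])
  have "reference J (permute_probs J \<sigma> \<pi>) = map_vec logistic (?Z x * C *\<^sub>v \<beta>) \<longleftrightarrow>
      reference J \<pi> = map_vec logistic (?Z x * (R ?\<tau> * C) *\<^sub>v \<beta>)"
    if \<beta>: "\<beta> \<in> carrier_vec q" and \<pi>: "\<pi> \<in> prob_simplex J" for x \<beta> \<pi>
  proof -
    have ZC: "?Z x * C \<in> carrier_mat (J - 1) q"
      by (rule mult_carrier_mat[OF complete_design_carrier C])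
    have "?Z x * (R ?\<tau> * C) = ?Z x * R ?\<tau> * C"
      by (rule assoc_mult_mat[OF complete_design_carrier blockwise_carrier C, symmetric])
    also have "\<dots> = rereference J ?\<tau> * ?Z x * C"
      by (simp only: complete_design_blockwise[OF rereference_carrier])
    also have "\<dots> = rereference J ?\<tau> * (?Z x * C)"
      by (rule assoc_mult_mat[OF rereference_carrier complete_design_carrier C])
    finally have "?Z x * (R ?\<tau> * C) *\<^sub>v \<beta> = rereference J ?\<tau> *\<^sub>v (?Z x * C *\<^sub>v \<beta>)"
      using assoc_mult_mat_vec[OF rereference_carrier ZC \<beta>] by simp
    then show ?thesis
      using reference_permute_iff[OF J \<sigma> \<pi> mult_mat_vec_carrier[OF ZC \<beta>]] by simp
  qed
  then show ?thesis
    unfolding model_eq_def model_of.simps permuted_model_of.simps model.simps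
      param_space_design[OF C X] param_space_design[OF RC X]
    \<comment> \<open>\<open>conj_cong\<close> supplies membership in the simplex, under which the
      conditions in the two definite descriptions are equivalent.\<close>
    by (simp cong: conj_cong)
qed

lemma design_matrices_mult_left:
  assumes "A \<in> carrier_mat n_params n_params" "B \<in> carrier_mat n_params n_params"
    and "A * B = 1\<^sub>m n_params"
    and "C \<in> carrier_mat n_params q" "vec_space.rank n_params C = q" "J - 1 + p \<le> q" "q \<le> n_params"
  shows "(\<lambda>x. complete_design J p x * (B * C)) \<in> design_matrices J p"
  unfolding design_matrices_def
  using full_column_rank_mult_left[OF assms(1-5)] mult_carrier_mat[OF assms(2,4)] assms(6,7) by blast

lemma stable_under_canonical_models: "stable_under J X \<sigma> (canonical_models J p)"
  unfolding stable_under_def family_eq_def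
proof (intro conjI ballI)
  let ?\<tau> = "inv_into UNIV \<sigma>"
  fix M assume "M \<in> permuted_model_of J X \<sigma> ` canonical_models J p"
  then obtain C q where C: "C \<in> carrier_mat n_params q" "vec_space.rank n_params C = q"
      "J - 1 + p \<le> q" "q \<le> n_params"
    and M: "M = permuted_model_of J X \<sigma> (reference J, logistic, \<lambda>x. complete_design J p x * C)"
    unfolding canonical_models_def design_matrices_def by blast
  have "(reference J, logistic, \<lambda>x. complete_design J p x * (R ?\<tau> * C)) \<in> canonical_models J p"
    using design_matrices_mult_left[OF blockwise_carrier blockwise_carrier
        blockwise_rereference_inverse(1) C]
    by (auto simp only: canonical_models_def)
  with permuted_model_eq[OF C(1)] show "\<exists>N\<in>model_of J X ` canonical_models J p. model_eq X M N"
    unfolding M by blast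
next
  let ?\<tau> = "inv_into UNIV \<sigma>"
  fix N assume "N \<in> model_of J X ` canonical_models J p"
  then obtain C q where C: "C \<in> carrier_mat n_params q" "vec_space.rank n_params C = q"
      "J - 1 + p \<le> q" "q \<le> n_params"
    and N: "N = model_of J X (reference J, logistic, \<lambda>x. complete_design J p x * C)"
    unfolding canonical_models_def design_matrices_def by blast
  \<comment> \<open>The model with matrix \<open>C\<close> arises by permuting the one with
    \<open>R \<sigma> * C\<close>, since \<open>R ?\<tau>\<close> undoes
    \<open>R \<sigma>\<close>.\<close>
  have RC: "R \<sigma> * C \<in> carrier_mat n_params q"
    by (rule mult_carrier_mat[OF blockwise_carrier C(1)])
  have "R ?\<tau> * (R \<sigma> * C) = R ?\<tau> * R \<sigma> * C"
    by (rule assoc_mult_mat[OF blockwise_carrier blockwise_carrier C(1), symmetric])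
  also have "\<dots> = C" by (simp only: blockwise_rereference_inverse left_mult_one_mat[OF C(1)])
  finally have "model_eq X N
      (permuted_model_of J X \<sigma> (reference J, logistic, \<lambda>x. complete_design J p x * (R \<sigma> * C)))"
    using permuted_model_eq[OF RC] unfolding N model_eq_def by auto
  moreover have "(reference J, logistic, \<lambda>x. complete_design J p x * (R \<sigma> * C)) \<in> canonical_models J p"
    using design_matrices_mult_left[OF blockwise_carrier blockwise_carrier
        blockwise_rereference_inverse(2) C]
    by (auto simp only: canonical_models_def)
  ultimately show "\<exists>M\<in>permuted_model_of J X \<sigma> ` canonical_models J p. model_eq X N M"
    by blast
qed

end

theorem corollary5:
  fixes J p :: nat and X :: "real vec set"
  assumes "3 \<le> J" and "1 \<le> p" and "X \<subseteq> carrier_vec p" and "X \<noteq> {}"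
  shows "\<forall>\<sigma>. \<sigma> permutes {1..J} \<longrightarrow> stable_under J X \<sigma> (canonical_models J p)"
  using assms by (auto intro: stable_under_canonical_models)

end
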